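(* Consider the 2D discrete system with state delays $$\begin{bmatrix}x^h(i+1,j)\\ x^v(i,j+1)\end{bmatrix}=A\begin{bmatrix}x^h(i,j)\\ x^v(i,j)\end{bmatrix}+A_d\begin{bmatrix}x^h(i-d_h(i),j)\\ x^v(i,j-d_v(j))\end{bmatrix},\qquad i,j\in\mathbb{Z}_+,$$ where $A,A_d$ are constant matrices of appropriate dimensions, with the delays and boundary conditions described in the context. For a given positive scalar $\alpha$, suppose there exist positive definite symmetric matrices $P=\mathrm{diag}\{P_h,P_v\}$, $Q_1=\mathrm{diag}\{Q_{1h},Q_{1v}\}$, $Q_2=\mathrm{diag}\{Q_{2h},Q_{2v}\}$, $W_1=\mathrm{diag}\{W_{1h},W_{1v}\}$, $W_2=\mathrm{diag}\{W_{2h},W_{2v}\}$ and, for $\bullet\in\{h,v\}$, $$X_\bullet=\begin{bmatrix}X_{11\bullet}&X_{12\bullet}\\ *&X_{22\bullet}\end{bmatrix},\qquad Y_\bullet=\begin{bmatrix}Y_{11\bullet}&Y_{12\bullet}\\ *&Y_{22\bullet}\end{bmatrix},$$ and any matrices $$M_\bullet=\begin{bmatrix}M_1^\bullet\\ M_2^\bullet\end{bmatrix},\quad N_\bullet=\begin{bmatrix}N_1^\bullet\\ N_2^\bullet\end{bmatrix},\quad S_\bullet=\begin{bmatrix}S_1^\bullet\\ S_2^\bullet\end{bmatrix}$$ of appropriate dimensions such that $$\Phi=\begin{bmatrix}\Phi_1&\Phi_2^T&\Phi_2^T&\Phi_3^TP\\ *&-\Lambda_1^{-1}W_1^{-1}&0&0\\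 *&*&-\Lambda_2^{-1}W_2^{-1}&0\\ *&*&*&-P\end{bmatrix}<0,\qquad \Psi=\mathrm{diag}\{\Psi_{1h},\Psi_{2h},\Psi_{3h},\Psi_{1v},\Psi_{2v},\Psi_{3v}\}\ge0,$$ where $\Lambda_1=\mathrm{diag}\{d_{hL}I_h,d_{vL}I_v\}$, $\Lambda_2=\mathrm{diag}\{(d_{hH}-d_{hL})I_h,(d_{vH}-d_{vL})I_v\}$, $\Lambda_3=\mathrm{diag}\{\alpha^{d_{hL}}I_h,\alpha^{d_{vL}}I_v\}$, $\Lambda_4=\mathrm{diag}\{\alpha^{d_{hH}}I_h,\alpha^{d_{vH}}I_v\}$; $X_{ab}=\mathrm{diag}\{X_{abh},X_{abv}\}$, $Y_{ab}=\mathrm{diag}\{Y_{abh},Y_{abv}\}$ for $ab\in\{11,12,22\}$; $M_a=\mathrm{diag}\{M_a^h,M_a^v\}$, $N_a=\mathrm{diag}\{N_a^h,N_a^v\}$, $S_a=\mathrm{diag}\{S_a^h,S_a^v\}$ for $a\in\{1,2\}$; $$\Phi_1=\begin{bmatrix}\Phi_{11}&\Phi_{12}&\Phi_{13}&\Phi_{14}\\ *&\Phi_{22}&\Phi_{23}&\Phi_{24}\\ *&*&\Phi_{33}&0\\ *&*&*&\Phi_{44}\end{bmatrix},$$ $\Phi_{11}=Q_1+Q_2+\Lambda_3(M_1+M_1^T+\Lambda_1X_{11})+\Lambda_2\Lambda_4Y_{11}-\alpha P$, $\Phi_{12}=\Lambda_3(\Lambda_1X_{12}+M_2^T)+\Lambda_4(N_1-S_1+\Lambda_2Y_{12})$,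 $\Phi_{13}=-\Lambda_3M_1+\Lambda_4S_1$, $\Phi_{14}=-\Lambda_4N_1$, $\Phi_{22}=\Lambda_1\Lambda_3X_{22}+\Lambda_4(N_2+N_2^T-S_2-S_2^T+\Lambda_2Y_{22})$, $\Phi_{23}=-\Lambda_3M_2+\Lambda_4S_2$, $\Phi_{24}=-\Lambda_4N_2$, $\Phi_{33}=-\Lambda_3Q_1$, $\Phi_{44}=-\Lambda_4Q_2$, $\Phi_2=\begin{bmatrix}A-I&A_d&0&0\end{bmatrix}$, $\Phi_3=\begin{bmatrix}A&A_d&0&0\end{bmatrix}$, and for $\bullet\in\{h,v\}$ $$\Psi_{1\bullet}=\begin{bmatrix}X_\bullet&M_\bullet\\ *&W_{1\bullet}\end{bmatrix},\quad\Psi_{2\bullet}=\begin{bmatrix}Y_\bullet&N_\bullet\\ *&W_{2\bullet}\end{bmatrix},\quad\Psi_{3\bullet}=\begin{bmatrix}Y_\bullet&S_\bullet\\ *&W_{2\bullet}\end{bmatrix}.$$ Then, along the trajectory of the system, the following inequality holds for integers $D>z\ge0$: $$\sum_{i+j=D}V(i,j)<\alpha^{D-z}\sum_{i+j=z}V(i,j),$$ where $V$ is the Lyapunov–Krasovskii functional defined in the context from $P,Q_1,Q_2,W_1,W_2,\alpha$.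
   Context: Notation. $\mathbb{Z}_+$ is the set of nonnegative integers; $X>Y$ (resp. $X\ge Y$) means $X-Y$ is positive definite (resp. positive semidefinite); $*$ in a symmetric matrix denotes the block determined by symmetry; $I_h,I_v$ are the identity matrices of sizes $n_1,n_2$. $x^h(i,j)\in\mathbb{R}^{n_1}$ and $x^v(i,j)\in\mathbb{R}^{n_2}$ are the horizontal and vertical states. Delays. $d_h(i),d_v(j)$ are the delays along the horizontal and vertical directions, with $d_{hL}\le d_h(i)\le d_{hH}$ and $d_{vL}\le d_v(j)\le d_{vH}$, where $d_{hL},d_{hH},d_{vL},d_{vH}$ are the lower and upper delay bounds. Boundary conditions. For finite positive integers $z_1,z_2$ and given vectors $h_{ij},v_{ij}$: $x^h(i,j)=h_{ij}$ for $0\le j\le z_1$, $-d_{hH}\le i\le0$; $x^h(i,j)=0$ for $j>z_1$, $-d_{hH}\le i\le0$; $x^v(i,j)=v_{ij}$ for $0\le i\le z_2$, $-d_{vH}\le j\le0$; $x^v(i,j)=0$ for $i>z_2$, $-d_{vH}\le j\le0$. Functional. With $\eta^h(r,j)=x^h(r+1,j)-x^h(r,j)$ and $\eta^v(i,t)=x^v(i,t+1)-x^v(i,t)$, set $V(i,j)=V^h(i,j)+V^v(i,j)$, where $$\begin{aligned}V^h(i,j)={}&x^h(i,j)^TP_hx^h(i,j)+\sum_{r=i-d_{hL}}^{i-1}x^h(r,j)^TQ_{1h}x^h(r,j)\alpha^{i-r-1}+\sum_{r=i-d_{hH}}^{i-1}x^h(r,j)^TQ_{2h}x^h(r,j)\alpha^{i-r-1}\\&+\sum_{s=-d_{hL}}^{-1}\sum_{r=i+s}^{i-1}\eta^h(r,j)^TW_{1h}\eta^h(r,j)\alpha^{i-r-1}+\sum_{s=-d_{hH}}^{-d_{hL}-1}\sum_{r=i+s}^{i-1}\eta^h(r,j)^TW_{2h}\eta^h(r,j)\alpha^{i-r-1},\end{aligned}$$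 $$\begin{aligned}V^v(i,j)={}&x^v(i,j)^TP_vx^v(i,j)+\sum_{t=j-d_{vL}}^{j-1}x^v(i,t)^TQ_{1v}x^v(i,t)\alpha^{j-t-1}+\sum_{t=j-d_{vH}}^{j-1}x^v(i,t)^TQ_{2v}x^v(i,t)\alpha^{j-t-1}\\&+\sum_{s=-d_{vL}}^{-1}\sum_{t=j+s}^{j-1}\eta^v(i,t)^TW_{1v}\eta^v(i,t)\alpha^{j-t-1}+\sum_{s=-d_{vH}}^{-d_{vL}-1}\sum_{t=j+s}^{j-1}\eta^v(i,t)^TW_{2v}\eta^v(i,t)\alpha^{j-t-1}.\end{aligned}$$ The sums over $i+j=D$ and $i+j=z$ run over $i,j\in\mathbb{Z}_+$.
   Formalization: Proved for α ≤ 1, for D > z ≥ max{z₁,z₂}, and when the sum of V(i,j) over i+j=z is nonzero (with 0 < d_L < d_H in both directions, so that Λ₁, Λ₂ are invertible); for α > 1, smaller z, or a zero sum the inequality as stated can fail. *)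

theory Defs
  imports "HOL-Analysis.Analysis"
begin

text \<open>
  Block vectors and matrices are indexed by sum types: the left summand indexes the first
  block. Three or more blocks are obtained by nesting.
\<close>

definition block_vec :: "'x^'a \<Rightarrow> 'x^'b \<Rightarrow> 'x^('a::finite + 'b::finite)" where
  "block_vec x y = (\<chi> i. case i of Inl a \<Rightarrow> x $ a | Inr b \<Rightarrow> y $ b)"

definition block_row :: "'x^'b^'a \<Rightarrow> 'x^'d^'a \<Rightarrow> 'x^('b::finite + 'd::finite)^'a" where
  "block_row A B = (\<chi> i. block_vec (A $ i) (B $ i))"

definition block_col :: "'x^'b^'a \<Rightarrow> 'x^'b^'c \<Rightarrow> 'x^'b^('a::finite + 'c::finite)" where
  "block_col A C = block_vec A C"

definition block_mat ::
  "'x^'b^'a \<Rightarrow> 'x^'d^'a \<Rightarrow> 'x^'b^'c \<Rightarrow> 'x^'d^'c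
    \<Rightarrow> 'x^('b::finite + 'd::finite)^('a::finite + 'c::finite)" where
  "block_mat A B C D = block_col (block_row A B) (block_row C D)"

definition block_diag ::
  "('x::zero)^'b^'a \<Rightarrow> 'x^'d^'c \<Rightarrow> 'x^('b::finite + 'd::finite)^('a::finite + 'c::finite)" where
  "block_diag A D = block_mat A 0 0 D"

text \<open>The matrix written \<open>[A, B; *, D]\<close>, whose lower left block is determined by symmetry.\<close>

definition block_sym ::
  "'x^'a^'a \<Rightarrow> 'x^'c^'a \<Rightarrow> 'x^'c^'c \<Rightarrow> 'x^('a::finite + 'c::finite)^('a + 'c)" where
  "block_sym A B D = block_mat A B (transpose B) D"

definition pos_def :: "real^'n^'n \<Rightarrow> bool" where
  "pos_def A \<longleftrightarrow> transpose A = A \<and> (\<forall>x. x \<noteq> 0 \<longrightarrow> 0 < x \<bullet> (A *v x))"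

definition pos_semidef :: "real^'n^'n \<Rightarrow> bool" where
  "pos_semidef A \<longleftrightarrow> transpose A = A \<and> (\<forall>x. 0 \<le> x \<bullet> (A *v x))"

text \<open>
  The horizontal state \<open>xh i j\<close> is needed for \<open>i \<ge> - dhH\<close>, \<open>j \<ge> 0\<close> and the vertical state
  \<open>xv i j\<close> for \<open>i \<ge> 0\<close>, \<open>j \<ge> - dvH\<close>; accordingly only the delayed coordinate is an integer.
\<close>

definition delay_system ::
  "real^('h::finite + 'v::finite)^('h + 'v) \<Rightarrow> real^('h + 'v)^('h + 'v)
    \<Rightarrow> (nat \<Rightarrow> nat) \<Rightarrow> (nat \<Rightarrow> nat)
    \<Rightarrow> (int \<Rightarrow> nat \<Rightarrow> real^'h) \<Rightarrow> (nat \<Rightarrow> int \<Rightarrow> real^'v) \<Rightarrow> bool" where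
  "delay_system A Ad dh dv xh xv \<longleftrightarrow>
    (\<forall>i j. block_vec (xh (int i + 1) j) (xv i (int j + 1)) =
       A *v block_vec (xh (int i) j) (xv i (int j)) +
       Ad *v block_vec (xh (int i - int (dh i)) j) (xv i (int j - int (dv j))))"

definition boundary_conditions ::
  "nat \<Rightarrow> nat \<Rightarrow> nat \<Rightarrow> nat \<Rightarrow> (int \<Rightarrow> nat \<Rightarrow> real^'h) \<Rightarrow> (nat \<Rightarrow> int \<Rightarrow> real^'v)
    \<Rightarrow> (int \<Rightarrow> nat \<Rightarrow> real^'h) \<Rightarrow> (nat \<Rightarrow> int \<Rightarrow> real^'v) \<Rightarrow> bool" where
  "boundary_conditions dhH dvH z1 z2 hb vb xh xv \<longleftrightarrow>
    (\<forall>i j. - int dhH \<le> i \<and> i \<le> 0 \<longrightarrow> xh i j = (if j \<le> z1 then hb i j else 0)) \<and>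
    (\<forall>i j. - int dvH \<le> j \<and> j \<le> 0 \<longrightarrow> xv i j = (if i \<le> z2 then vb i j else 0))"

text \<open>
  The horizontal and vertical parts of the functional are given by the same expression in the
  state as a function of the delayed coordinate: \<open>V\<^sup>h(i,j)\<close> is obtained from
  \<open>r \<mapsto> x\<^sup>h(r,j)\<close> at \<open>i\<close> and \<open>V\<^sup>v(i,j)\<close> from \<open>t \<mapsto> x\<^sup>v(i,t)\<close> at \<open>j\<close>. The exponents
  \<open>k - r - 1\<close> are nonnegative throughout the ranges of summation.
\<close>

definition lk_part ::
  "real \<Rightarrow> nat \<Rightarrow> nat \<Rightarrow> real^'n^'n \<Rightarrow> real^'n^'n \<Rightarrow> real^'n^'n \<Rightarrow> real^'n^'n \<Rightarrow> real^'n^'n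
    \<Rightarrow> (int \<Rightarrow> real^'n) \<Rightarrow> int \<Rightarrow> real" where
  "lk_part \<alpha> dL dH P Q1 Q2 W1 W2 x k =
    (let \<eta> = (\<lambda>r. x (r + 1) - x r) in
      x k \<bullet> (P *v x k)
      + (\<Sum>r\<in>{k - int dL..k - 1}. x r \<bullet> (Q1 *v x r) * \<alpha> powi (k - r - 1))
      + (\<Sum>r\<in>{k - int dH..k - 1}. x r \<bullet> (Q2 *v x r) * \<alpha> powi (k - r - 1))
      + (\<Sum>s\<in>{- int dL..-1}. \<Sum>r\<in>{k + s..k - 1}. \<eta> r \<bullet> (W1 *v \<eta> r) * \<alpha> powi (k - r - 1))
      + (\<Sum>s\<in>{- int dH..- int dL - 1}. \<Sum>r\<in>{k + s..k - 1}.
           \<eta> r \<bullet> (W2 *v \<eta> r) * \<alpha> powi (k - r - 1)))"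

end

theory Submission
  imports Defs
begin

text \<open>
  Write \<open>F i j\<close> and \<open>G i j\<close> for the horizontal and the vertical part of \<open>V i j\<close>. The theorem follows
  from the local inequality
  \<open>F (i + 1) j + G i (j + 1) \<le> \<alpha> * V i j\<close>, which is strict whenever \<open>V i j \<noteq> 0\<close>. Summed over an
  antidiagonal \<open>i + j = n\<close>, its left-hand sides are the terms of the next antidiagonal except for
  \<open>F 0 (n + 1)\<close> and \<open>G (n + 1) 0\<close>; these depend only on boundary data, which vanish because
  \<open>n \<ge> max z1 z2\<close>. Hence the antidiagonal sums are multiplied by at most \<open>\<alpha>\<close> at every
  step, and the first step is strict because the initial sum is nonzero
  (\<open>antidiagonal_decay\<close>).

  For the local inequality, one step of the functional is computed exactly in each direction
  (\<open>lk_part_step\<close>). Apart from terms in the current, next and delayed states it contains two negative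
  sums over the past increments. The conditions \<open>\<Psi> \<ge> 0\<close> say that these sums are bounded by
  quadratic forms in the current state and the delayed states, because increments telescope
  (\<open>slack_sum_nonneg\<close>, \<open>lk_part_step_le\<close>). The two directions together give the quadratic form of \<open>\<Phi>1\<close>
  at the vector \<open>\<xi>\<close> of current and delayed states (\<open>lmi_form_sum\<close>), plus the terms of the next
  state and of the newest increment, which are linear images \<open>\<Phi>3 *v \<xi>\<close> and \<open>\<Phi>2 *v \<xi>\<close>. The
  total is the Schur complement of \<open>\<Phi>\<close>, hence negative for \<open>\<xi> \<noteq> 0\<close> (\<open>neg_def_schur\<close>). For
  \<open>\<xi> = 0\<close> the exact step formula shows strict decay unless the functional is zero
  (\<open>lk_part_at_rest\<close>).
\<close>

section \<open>Block vectors and block matrices\<close>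

lemma sum_UNIV_Plus:
  "(\<Sum>i\<in>UNIV. f i) = (\<Sum>a\<in>UNIV. f (Inl a)) + (\<Sum>b\<in>UNIV. f (Inr b))"
  for f :: "'a::finite + 'b::finite \<Rightarrow> 'c::comm_monoid_add"
  by (simp add: sum.Plus UNIV_Plus_UNIV[symmetric] del: UNIV_Plus_UNIV)

lemma block_vec_nth [simp]:
  "block_vec x y $ Inl a = x $ a" "block_vec x y $ Inr b = y $ b"
  by (simp_all add: block_vec_def)

lemma vec_eq_iff_blocks:
  "x = y \<longleftrightarrow> (\<forall>a. x $ Inl a = y $ Inl a) \<and> (\<forall>b. x $ Inr b = y $ Inr b)"
  for x y :: "'x^('a::finite + 'b::finite)"
  by (metis vec_eq_iff sum.exhaust)

lemma block_vec_diff: "block_vec x y - block_vec u v = block_vec (x - u) (y - v)"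
  for x :: "real^'a" and y :: "real^'b"
  by (simp add: vec_eq_iff_blocks)

lemma block_vec_zero: "block_vec 0 0 = 0"
  by (simp add: vec_eq_iff_blocks)

lemma block_vec_eq_iff: "block_vec x y = block_vec u v \<longleftrightarrow> x = u \<and> y = v"
  by (simp add: vec_eq_iff_blocks) (simp add: vec_eq_iff)

lemma block_vec_eq_0_iff: "block_vec x y = 0 \<longleftrightarrow> x = 0 \<and> y = 0"
  by (metis block_vec_zero block_vec_eq_iff)

lemma inner_block_vec: "block_vec x y \<bullet> block_vec u v = x \<bullet> u + y \<bullet> v"
  for x :: "real^'a" and y :: "real^'b"
  by (simp add: inner_vec_def sum_UNIV_Plus)

lemma block_row_mult: "block_row A B *v block_vec x y = A *v x + B *v y"
  for x :: "real^'a" and y :: "real^'b"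
  by (simp add: vec_eq_iff matrix_vector_mult_def block_row_def sum_UNIV_Plus)

lemma block_col_mult: "block_col A C *v x = block_vec (A *v x) (C *v x)"
  for x :: "real^'a"
  by (simp add: vec_eq_iff_blocks matrix_vector_mult_def block_col_def)

lemma block_mat_mult:
  "block_mat A B C D *v block_vec x y = block_vec (A *v x + B *v y) (C *v x + D *v y)"
  for x :: "real^'a" and y :: "real^'b"
  by (simp add: block_mat_def block_col_mult block_row_mult)

lemma block_diag_mult: "block_diag A D *v block_vec x y = block_vec (A *v x) (D *v y)"
  for x :: "real^'a" and y :: "real^'b"
  by (simp add: block_diag_def block_mat_mult)

lemma transpose_block_diag:
  "transpose (block_diag A D) = block_diag (transpose A) (transpose D)"
  by (simp add: vec_eq_iff_blocks transpose_def block_diag_def block_mat_def block_col_def block_row_def)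

lemma mat_mult_vec: "mat c *v x = c *\<^sub>R x" for x :: "real^'n"
  by (simp add: vec_eq_iff matrix_vector_mult_def mat_def if_distrib[of "\<lambda>t. t * _"] cong: if_cong)

lemma uminus_mult_vec: "(- A) *v x = - (A *v x)" for A :: "real^'n^'m"
  by (simp add: vec_eq_iff matrix_vector_mult_def sum_negf)

text \<open>
  Every mixed term of a quadratic form is brought into the shape \<open>x \<bullet> (A *v y)\<close> without
  transposes, so that equality of quadratic forms becomes linear arithmetic.
\<close>

lemma inner_transpose_mult: "x \<bullet> (transpose A *v y) = y \<bullet> (A *v x)" for A :: "real^'n^'m"
  by (metis dot_lmul_matrix inner_commute transpose_matrix_vector)

lemma quadform_block_sym:
  "block_vec x y \<bullet> (block_sym A B D *v block_vec x y)
    = x \<bullet> (A *v x) + 2 * (x \<bullet> (B *v y)) + y \<bullet> (D *v y)"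
  for x :: "real^'a" and y :: "real^'b"
  by (simp add: block_sym_def block_mat_mult inner_block_vec inner_add_right inner_transpose_mult
      del: transpose_matrix_vector)

lemma pos_def_block_diagD:
  assumes "pos_def (block_diag A D)" shows "pos_def A" "pos_def D"
proof -
  have "block_diag (transpose A) (transpose D) = block_diag A D"
    using assms by (simp add: pos_def_def transpose_block_diag)
  then have sym: "transpose A = A" "transpose D = D"
    by (auto simp: vec_eq_iff block_diag_def block_mat_def block_col_def block_row_def block_vec_def
        split: sum.splits)
  have pos: "0 < block_vec x y \<bullet> (block_diag A D *v block_vec x y)" if "x \<noteq> 0 \<or> y \<noteq> 0" for x y
    using assms that by (simp add: pos_def_def block_vec_eq_0_iff)
  show "pos_def A"
    using pos[of _ 0] sym by (auto simp: pos_def_def block_diag_mult inner_block_vec)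
  show "pos_def D"
    using pos[of 0] sym by (auto simp: pos_def_def block_diag_mult inner_block_vec)
qed

lemma pos_semidef_block_diagD:
  assumes "pos_semidef (block_diag A D)" shows "pos_semidef A" "pos_semidef D"
proof -
  have "block_diag (transpose A) (transpose D) = block_diag A D"
    using assms by (simp add: pos_semidef_def transpose_block_diag)
  then have sym: "transpose A = A" "transpose D = D"
    by (auto simp: vec_eq_iff block_diag_def block_mat_def block_col_def block_row_def block_vec_def
        split: sum.splits)
  have pos: "0 \<le> block_vec x y \<bullet> (block_diag A D *v block_vec x y)" for x y
    using assms by (simp add: pos_semidef_def)
  show "pos_semidef A"
    using pos[of _ 0] sym by (auto simp: pos_semidef_def block_diag_mult inner_block_vec)
  show "pos_semidef D"
    using pos[of 0] sym by (auto simp: pos_semidef_def block_diag_mult inner_block_vec)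
qed

lemma pos_def_nonneg: "pos_def A \<Longrightarrow> 0 \<le> x \<bullet> (A *v x)"
  by (cases "x = 0") (auto simp: pos_def_def intro: less_imp_le)

lemma matrix_inv_mult_vec:
  fixes A :: "real^'n^'n"
  assumes "\<And>x. A *v x = 0 \<Longrightarrow> x = 0"
  shows "matrix_inv A *v (A *v x) = x"
proof -
  have "\<exists>B. A ** B = mat 1 \<and> B ** A = mat 1"
    using assms by (metis matrix_left_invertible_ker matrix_left_right_inverse)
  then have "matrix_inv A ** A = mat 1"
    unfolding matrix_inv_def by (rule someI2_ex) simp
  then show ?thesis by (simp add: matrix_vector_mul_assoc)
qed

lemma pos_def_ker: "pos_def A \<Longrightarrow> A *v x = 0 \<Longrightarrow> x = 0"
  unfolding pos_def_def by force

section \<open>One step of the functional in a single direction\<close>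

text \<open>
  Moving the window by one multiplies every old weight by \<open>\<alpha>\<close>, adds the newest term with weight
  \<open>1\<close> and drops the oldest, whose weight has meanwhile become \<open>\<alpha>\<^sup>m\<close>. The window length is
  an integer so that the rule also applies to the windows \<open>{k + s..k - 1}\<close> of the double sums, with
  \<open>m = - s\<close>.
\<close>

lemma discounted_sum_shift:
  fixes f :: "int \<Rightarrow> real"
  assumes "\<alpha> \<noteq> 0" "0 \<le> m"
  shows "(\<Sum>r\<in>{k + 1 - m..k + 1 - 1}. f r * \<alpha> powi (k + 1 - r - 1))
    = \<alpha> * (\<Sum>r\<in>{k - m..k - 1}. f r * \<alpha> powi (k - r - 1)) + f k - \<alpha> powi m * f (k - m)"
proof -
  let ?g = "\<lambda>r. f r * \<alpha> powi (k - r)"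
  have top: "{k - m..k} = insert k {k - m..k - 1}"
    and bottom: "{k - m..k} = insert (k - m) {k + 1 - m..k}"
    using assms by auto
  have "\<alpha> * (\<Sum>r\<in>{k - m..k - 1}. f r * \<alpha> powi (k - r - 1)) = (\<Sum>r\<in>{k - m..k - 1}. ?g r)"
    unfolding sum_distrib_left
  proof (rule sum.cong[OF refl])
    fix r show "\<alpha> * (f r * \<alpha> powi (k - r - 1)) = f r * \<alpha> powi (k - r)"
      using power_int_add_1[of \<alpha> "k - r - 1"] assms by simp
  qed
  moreover have "(\<Sum>r\<in>{k - m..k}. ?g r) = ?g k + (\<Sum>r\<in>{k - m..k - 1}. ?g r)"
    unfolding top by simp
  moreover have "(\<Sum>r\<in>{k - m..k}. ?g r) = ?g (k - m) + (\<Sum>r\<in>{k + 1 - m..k}. ?g r)"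
    unfolding bottom by simp
  ultimately show ?thesis by (simp add: algebra_simps)
qed

text \<open>
  Each window sum is moved on by \<open>discounted_sum_shift\<close>. In a double sum the newest increment is
  gained once for every window, which gives the factors \<open>dL\<close> and \<open>dH - dL\<close>, whereas each window
  loses a different increment, so that the losses add up to a single discounted sum over the past.
\<close>

lemma lk_part_step:
  fixes x :: "int \<Rightarrow> real^'n" and k :: int
  defines "\<eta> \<equiv> \<lambda>r. x (r + 1) - x r"
  assumes "\<alpha> \<noteq> 0" "dL \<le> dH"
  shows "lk_part \<alpha> dL dH P Q1 Q2 W1 W2 x (k + 1) = \<alpha> * lk_part \<alpha> dL dH P Q1 Q2 W1 W2 x k
    + x (k + 1) \<bullet> (P *v x (k + 1)) - \<alpha> * (x k \<bullet> (P *v x k))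
    + x k \<bullet> (Q1 *v x k) - \<alpha> ^ dL * (x (k - int dL) \<bullet> (Q1 *v x (k - int dL)))
    + x k \<bullet> (Q2 *v x k) - \<alpha> ^ dH * (x (k - int dH) \<bullet> (Q2 *v x (k - int dH)))
    + real dL * (\<eta> k \<bullet> (W1 *v \<eta> k)) + (real dH - real dL) * (\<eta> k \<bullet> (W2 *v \<eta> k))
    - (\<Sum>r\<in>{k - int dL..k - 1}. \<alpha> powi (k - r) * (\<eta> r \<bullet> (W1 *v \<eta> r)))
    - (\<Sum>r\<in>{k - int dH..k - int dL - 1}. \<alpha> powi (k - r) * (\<eta> r \<bullet> (W2 *v \<eta> r)))"
proof -
  have double: "(\<Sum>s\<in>{- b..- a - 1}. \<Sum>r\<in>{k + 1 + s..k + 1 - 1}. f r * \<alpha> powi (k + 1 - r - 1))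
      = \<alpha> * (\<Sum>s\<in>{- b..- a - 1}. \<Sum>r\<in>{k + s..k - 1}. f r * \<alpha> powi (k - r - 1))
        + real_of_int (b - a) * f k - (\<Sum>r\<in>{k - b..k - a - 1}. \<alpha> powi (k - r) * f r)"
    if "0 \<le> a" "a \<le> b" for a b and f :: "int \<Rightarrow> real"
  proof -
    have "(\<Sum>s\<in>{- b..- a - 1}. \<Sum>r\<in>{k + 1 + s..k + 1 - 1}. f r * \<alpha> powi (k + 1 - r - 1))
      = (\<Sum>s\<in>{- b..- a - 1}. \<alpha> * (\<Sum>r\<in>{k + s..k - 1}. f r * \<alpha> powi (k - r - 1)) + f k
           - \<alpha> powi (- s) * f (k + s))"
    proof (rule sum.cong[OF refl])
      fix s assume "s \<in> {- b..- a - 1}"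
      with that have "0 \<le> - s" by auto
      from discounted_sum_shift[OF assms(2) this, where k = k and f = f, unfolded diff_minus_eq_add]
      show "(\<Sum>r\<in>{k + 1 + s..k + 1 - 1}. f r * \<alpha> powi (k + 1 - r - 1))
          = \<alpha> * (\<Sum>r\<in>{k + s..k - 1}. f r * \<alpha> powi (k - r - 1)) + f k - \<alpha> powi (- s) * f (k + s)" .
    qed
    also have "\<dots> = \<alpha> * (\<Sum>s\<in>{- b..- a - 1}. \<Sum>r\<in>{k + s..k - 1}. f r * \<alpha> powi (k - r - 1))
        + real_of_int (b - a) * f k - (\<Sum>s\<in>{- b..- a - 1}. \<alpha> powi (- s) * f (k + s))"
      using that by (simp add: sum.distrib sum_subtractf sum_distrib_left)
    also have "(\<Sum>s\<in>{- b..- a - 1}. \<alpha> powi (- s) * f (k + s))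
        = (\<Sum>r\<in>{k - b..k - a - 1}. \<alpha> powi (k - r) * f r)"
      by (rule sum.reindex_bij_witness[of _ "\<lambda>r. r - k" "\<lambda>s. k + s"]) auto
    finally show ?thesis .
  qed
  show ?thesis
    unfolding lk_part_def Let_def \<eta>_def
    using discounted_sum_shift[OF assms(2), where k = k and m = "int dL"
        and f = "\<lambda>r. x r \<bullet> (Q1 *v x r)"]
      discounted_sum_shift[OF assms(2), where k = k and m = "int dH"
        and f = "\<lambda>r. x r \<bullet> (Q2 *v x r)"]
      double[of 0 "int dL" "\<lambda>r. (x (r + 1) - x r) \<bullet> (W1 *v (x (r + 1) - x r))"]
      double[of "int dL" "int dH" "\<lambda>r. (x (r + 1) - x r) \<bullet> (W2 *v (x (r + 1) - x r))"] assms(3)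
    by (simp add: algebra_simps)
qed

lemma lk_part_eq_0:
  assumes "dL \<le> dH" "\<And>r. k - int dH \<le> r \<Longrightarrow> r \<le> k \<Longrightarrow> x r = 0"
  shows "lk_part \<alpha> dL dH P Q1 Q2 W1 W2 x k = 0"
proof -
  have "x (r + 1) - x r = 0" if "k - int dH \<le> r" "r \<le> k - 1" for r
    using that assms(2)[of r] assms(2)[of "r + 1"] by simp
  then show ?thesis
    unfolding lk_part_def Let_def using assms
    by (simp add: sum.neutral)
qed

text \<open>
  When the current, the next and the two boundary delayed states vanish, only the losses
  of the double sums are left in \<open>lk_part_step\<close>. As \<open>W1\<close> and \<open>W2\<close> are positive definite, no loss
  at all would mean that the state was constant over the whole delay range, hence zero there,
  and then the functional itself would vanish. This provides strict decay where the negative definite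
  form does not, namely at its zero.
\<close>

lemma lk_part_at_rest:
  fixes x :: "int \<Rightarrow> real^'n"
  assumes "0 < \<alpha>" "dL \<le> dH" "pos_def W1" "pos_def W2"
    and rest: "x k = 0" "x (k + 1) = 0" "x (k - int dL) = 0" "x (k - int dH) = 0"
  shows "lk_part \<alpha> dL dH P Q1 Q2 W1 W2 x (k + 1) \<le> \<alpha> * lk_part \<alpha> dL dH P Q1 Q2 W1 W2 x k"
    and "lk_part \<alpha> dL dH P Q1 Q2 W1 W2 x k \<noteq> 0 \<Longrightarrow>
      lk_part \<alpha> dL dH P Q1 Q2 W1 W2 x (k + 1) < \<alpha> * lk_part \<alpha> dL dH P Q1 Q2 W1 W2 x k"
proof -
  define \<eta> where "\<eta> r = x (r + 1) - x r" for r
  define S1 where "S1 = (\<Sum>r\<in>{k - int dL..k - 1}. \<alpha> powi (k - r) * (\<eta> r \<bullet> (W1 *v \<eta> r)))"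
  define S2 where "S2 = (\<Sum>r\<in>{k - int dH..k - int dL - 1}. \<alpha> powi (k - r) * (\<eta> r \<bullet> (W2 *v \<eta> r)))"
  let ?L = "lk_part \<alpha> dL dH P Q1 Q2 W1 W2 x"
  have step: "?L (k + 1) = \<alpha> * ?L k - S1 - S2"
    using lk_part_step[of \<alpha> dL dH P Q1 Q2 W1 W2 x k] assms
    by (simp add: S1_def S2_def \<eta>_def)
  have nonneg: "0 \<le> \<alpha> powi (k - r) * (\<eta> r \<bullet> (W1 *v \<eta> r))" "0 \<le> \<alpha> powi (k - r) * (\<eta> r \<bullet> (W2 *v \<eta> r))" for r
    using assms by (simp_all add: pos_def_nonneg)
  then have S: "0 \<le> S1" "0 \<le> S2"
    by (auto simp: S1_def S2_def intro!: sum_nonneg)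
  then show "?L (k + 1) \<le> \<alpha> * ?L k"
    using step by simp
  show "?L (k + 1) < \<alpha> * ?L k" if "?L k \<noteq> 0"
  proof (rule ccontr)
    assume "\<not> ?thesis"
    then have 0: "S1 = 0" "S2 = 0"
      using step S by auto
    have \<eta>0: "\<eta> r = 0" if r: "k - int dH \<le> r" "r \<le> k - 1" for r
    proof -
      have "\<eta> r \<bullet> (W1 *v \<eta> r) = 0 \<or> \<eta> r \<bullet> (W2 *v \<eta> r) = 0"
        using 0 r nonneg \<open>0 < \<alpha>\<close> unfolding S1_def S2_def
        by (cases "k - int dL \<le> r") (auto simp: sum_nonneg_eq_0_iff)
      then show ?thesis
        using \<open>pos_def W1\<close> \<open>pos_def W2\<close> by (metis less_irrefl pos_def_def)
    qed
    have "x r = 0" if "k - int dH \<le> r" "r \<le> k" for r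
      using that(2,1)
    proof (induction rule: int_le_induct)
      case base
      show ?case by (rule rest)
    next
      case (step r)
      then show ?case using \<eta>0[of "r - 1"] by (simp add: \<eta>_def)
    qed
    then show False using lk_part_eq_0[OF \<open>dL \<le> dH\<close>] that by blast
  qed
qed

text \<open>
  The form of \<open>block_sym X M W\<close> at \<open>(\<zeta>, x (r + 1) - x r)\<close> is nonnegative; in the sum over \<open>r\<close> the
  terms linear in the increment telescope. This bounds the \<open>W\<close>-form summed over
  the increments from below by an expression in \<open>\<zeta>\<close> and the two end states only, whatever the
  intermediate states are.
\<close>

lemma slack_sum_nonneg:
  fixes x :: "int \<Rightarrow> real^'n"
  assumes psd: "pos_semidef (block_sym X M W)" and "a \<le> b"
  shows "0 \<le> real_of_int (b - a) * (\<zeta> \<bullet> (X *v \<zeta>)) + 2 * (\<zeta> \<bullet> (M *v (x b - x a)))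
    + (\<Sum>r\<in>{a..b - 1}. (x (r + 1) - x r) \<bullet> (W *v (x (r + 1) - x r)))"
  using \<open>a \<le> b\<close>
proof (induction rule: int_ge_induct)
  case base
  show ?case by simp
next
  case (step b)
  let ?\<eta> = "x (b + 1) - x b"
  have "0 \<le> \<zeta> \<bullet> (X *v \<zeta>) + 2 * (\<zeta> \<bullet> (M *v ?\<eta>)) + ?\<eta> \<bullet> (W *v ?\<eta>)"
    using psd unfolding pos_semidef_def quadform_block_sym[symmetric] by blast
  moreover have "{a..b + 1 - 1} = insert b {a..b - 1}"
    using step.hyps by auto
  ultimately show ?case
    using step.IH by (simp add: algebra_simps matrix_vector_mult_diff_distrib inner_diff_right)
qed

text \<open>
  The share of one direction in the quadratic form of \<open>\<Phi>1\<close>, written in the shape in which it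
  comes out of the step estimate: \<open>x\<close> is the current state, and \<open>y\<close>, \<open>u\<close>, \<open>w\<close> are the states
  delayed by \<open>d\<close>, \<open>dL\<close> and \<open>dH\<close>.
\<close>

definition lmi_form ::
  "real \<Rightarrow> nat \<Rightarrow> nat \<Rightarrow> real^'n^'n \<Rightarrow> real^'n^'n \<Rightarrow> real^'n^'n
    \<Rightarrow> real^('n + 'n)^('n + 'n) \<Rightarrow> real^('n + 'n)^('n + 'n)
    \<Rightarrow> real^'n^('n + 'n) \<Rightarrow> real^'n^('n + 'n) \<Rightarrow> real^'n^('n + 'n)
    \<Rightarrow> real^'n \<Rightarrow> real^'n \<Rightarrow> real^'n \<Rightarrow> real^'n \<Rightarrow> real" where
  "lmi_form \<alpha> dL dH P Q1 Q2 X Y M N S x y u w =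
    (let \<zeta> = block_vec x y in
      x \<bullet> (Q1 *v x) + x \<bullet> (Q2 *v x) - \<alpha> * (x \<bullet> (P *v x))
      + \<alpha> ^ dL * (real dL * (\<zeta> \<bullet> (X *v \<zeta>)) + 2 * (\<zeta> \<bullet> (M *v (x - u))) - u \<bullet> (Q1 *v u))
      + \<alpha> ^ dH * ((real dH - real dL) * (\<zeta> \<bullet> (Y *v \<zeta>)) + 2 * (\<zeta> \<bullet> (N *v (y - w)))
          + 2 * (\<zeta> \<bullet> (S *v (u - y))) - w \<bullet> (Q2 *v w)))"

text \<open>
  In \<open>lk_part_step\<close>, the weights \<open>\<alpha> powi (k - r)\<close> of the losses are at least \<open>\<alpha>\<^bsup>dL\<^esup>\<close> on the
  recent part and at least \<open>\<alpha>\<^bsup>dH\<^esup>\<close> on the older part of the past, because \<open>\<alpha> \<le> 1\<close>. The recent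
  losses are then estimated by \<open>slack_sum_nonneg\<close> with \<open>X\<close> and \<open>M\<close>. The older part
  is cut at the actual delay \<open>d\<close>, and the two pieces are estimated with \<open>N\<close> and \<open>S\<close>;
  since both use the same \<open>Y\<close>, their lengths add up to \<open>dH - dL\<close> and \<open>d\<close> disappears from the
  coefficients.
\<close>

lemma lk_part_step_le:
  fixes x :: "int \<Rightarrow> real^'n" and k :: int
  defines "\<eta> \<equiv> x (k + 1) - x k"
  assumes \<alpha>: "0 < \<alpha>" "\<alpha> \<le> 1" and d: "dL \<le> d" "d \<le> dH"
    and W: "pos_def W1" "pos_def W2"
    and \<Psi>: "pos_semidef (block_sym X M W1)" "pos_semidef (block_sym Y N W2)"
      "pos_semidef (block_sym Y S W2)"
  shows "lk_part \<alpha> dL dH P Q1 Q2 W1 W2 x (k + 1) \<le> \<alpha> * lk_part \<alpha> dL dH P Q1 Q2 W1 W2 x k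
    + x (k + 1) \<bullet> (P *v x (k + 1))
    + real dL * (\<eta> \<bullet> (W1 *v \<eta>)) + (real dH - real dL) * (\<eta> \<bullet> (W2 *v \<eta>))
    + lmi_form \<alpha> dL dH P Q1 Q2 X Y M N S (x k) (x (k - int d)) (x (k - int dL)) (x (k - int dH))"
proof -
  define w1 where "w1 r = (x (r + 1) - x r) \<bullet> (W1 *v (x (r + 1) - x r))" for r
  define w2 where "w2 r = (x (r + 1) - x r) \<bullet> (W2 *v (x (r + 1) - x r))" for r
  define \<zeta> where "\<zeta> = block_vec (x k) (x (k - int d))"
  have nonneg: "0 \<le> w1 r" "0 \<le> w2 r" for r
    by (simp_all add: w1_def w2_def W pos_def_nonneg)
  have pow: "\<alpha> ^ n \<le> \<alpha> powi (k - r)" if "k - int n \<le> r" "r \<le> k" for n r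
  proof -
    have "\<alpha> powi (k - r) = \<alpha> ^ nat (k - r)"
      using that by (simp add: power_int_def)
    then show ?thesis
      using \<alpha> that by (simp add: power_decreasing)
  qed
  have "\<alpha> ^ dL * (\<Sum>r\<in>{k - int dL..k - 1}. w1 r) \<le> (\<Sum>r\<in>{k - int dL..k - 1}. \<alpha> powi (k - r) * w1 r)"
    unfolding sum_distrib_left by (intro sum_mono mult_right_mono pow nonneg) auto
  moreover have "0 \<le> real dL * (\<zeta> \<bullet> (X *v \<zeta>)) + 2 * (\<zeta> \<bullet> (M *v (x k - x (k - int dL))))
      + (\<Sum>r\<in>{k - int dL..k - 1}. w1 r)"
    using slack_sum_nonneg[OF \<Psi>(1), of "k - int dL" k \<zeta> x] by (simp add: w1_def)
  then have "0 \<le> \<alpha> ^ dL * (real dL * (\<zeta> \<bullet> (X *v \<zeta>)) + 2 * (\<zeta> \<bullet> (M *v (x k - x (k - int dL))))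
      + (\<Sum>r\<in>{k - int dL..k - 1}. w1 r))"
    using \<alpha> by simp
  moreover have "\<alpha> ^ dH * (\<Sum>r\<in>{k - int dH..k - int dL - 1}. w2 r)
      \<le> (\<Sum>r\<in>{k - int dH..k - int dL - 1}. \<alpha> powi (k - r) * w2 r)"
    unfolding sum_distrib_left by (intro sum_mono mult_right_mono pow nonneg) auto
  moreover have "0 \<le> (real dH - real dL) * (\<zeta> \<bullet> (Y *v \<zeta>))
      + 2 * (\<zeta> \<bullet> (N *v (x (k - int d) - x (k - int dH))))
      + 2 * (\<zeta> \<bullet> (S *v (x (k - int dL) - x (k - int d))))
      + (\<Sum>r\<in>{k - int dH..k - int dL - 1}. w2 r)"
  proof -
    (* The increments from k - dH to k - d are estimated with N, those from k - d to k - dL with S. *)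
    have "{k - int dH..k - int dL - 1} = {k - int dH..k - int d - 1} \<union> {k - int d..k - int dL - 1}"
      using d by auto
    then have "(\<Sum>r\<in>{k - int dH..k - int dL - 1}. w2 r)
        = (\<Sum>r\<in>{k - int dH..k - int d - 1}. w2 r) + (\<Sum>r\<in>{k - int d..k - int dL - 1}. w2 r)"
      by (simp add: sum.union_disjoint disjoint_iff)
    then show ?thesis
      using slack_sum_nonneg[OF \<Psi>(2), of "k - int dH" "k - int d" \<zeta> x]
        slack_sum_nonneg[OF \<Psi>(3), of "k - int d" "k - int dL" \<zeta> x] d
      by (simp add: w2_def algebra_simps)
  qed
  then have "0 \<le> \<alpha> ^ dH * ((real dH - real dL) * (\<zeta> \<bullet> (Y *v \<zeta>))
      + 2 * (\<zeta> \<bullet> (N *v (x (k - int d) - x (k - int dH))))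
      + 2 * (\<zeta> \<bullet> (S *v (x (k - int dL) - x (k - int d))))
      + (\<Sum>r\<in>{k - int dH..k - int dL - 1}. w2 r))"
    using \<alpha> by simp
  ultimately show ?thesis
    using lk_part_step[of \<alpha> dL dH P Q1 Q2 W1 W2 x k] \<alpha> d
    unfolding lmi_form_def Let_def \<eta>_def \<zeta>_def[symmetric] w1_def[symmetric] w2_def[symmetric]
    by (simp add: ring_distribs)
qed

section \<open>Decay along antidiagonals\<close>

lemma antidiagonal_sum:
  "(\<Sum>(i, j)\<in>{(i, j). i + j = n}. f i j) = (\<Sum>i\<le>n. f i (n - i))" for n :: nat
  by (rule sum.reindex_bij_witness[of _ "\<lambda>i. (i, n - i)" fst]) auto

text \<open>
  Advancing \<open>F\<close> in its first and \<open>G\<close> in its second argument turns the terms of one antidiagonal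
  into those of the next, apart from \<open>F 0 (n + 1)\<close> and \<open>G (n + 1) 0\<close>, which vanish
  beyond \<open>z\<close>. Strictness is needed only once, on the antidiagonal \<open>z\<close>: its sum is nonzero, so
  one of its terms is.
\<close>

lemma antidiagonal_decay:
  fixes F G :: "nat \<Rightarrow> nat \<Rightarrow> real"
  defines "S \<equiv> \<lambda>n. (\<Sum>(i, j)\<in>{(i, j). i + j = n}. F i j + G i j)"
  assumes "0 < \<alpha>"
    and step: "\<And>i j. F (Suc i) j + G i (Suc j) \<le> \<alpha> * (F i j + G i j)"
    and strict: "\<And>i j. F i j + G i j \<noteq> 0 \<Longrightarrow> F (Suc i) j + G i (Suc j) < \<alpha> * (F i j + G i j)"
    and bdry: "\<And>n. z < n \<Longrightarrow> F 0 n = 0" "\<And>n. z < n \<Longrightarrow> G n 0 = 0"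
    and "z < D" "S z \<noteq> 0"
  shows "S D < \<alpha> ^ (D - z) * S z"
proof -
  have next_diag: "S (Suc n) = (\<Sum>i\<le>n. F (Suc i) (n - i) + G i (Suc (n - i)))" if "z \<le> n" for n
  proof -
    have "S (Suc n) = (\<Sum>i\<le>Suc n. F i (Suc n - i)) + (\<Sum>i\<le>Suc n. G i (Suc n - i))"
      by (simp only: S_def antidiagonal_sum sum.distrib)
    also have "(\<Sum>i\<le>Suc n. F i (Suc n - i)) = (\<Sum>i\<le>n. F (Suc i) (n - i))"
      using bdry(1)[of "Suc n"] that by (simp only: sum.atMost_Suc_shift) simp
    also have "(\<Sum>i\<le>Suc n. G i (Suc n - i)) = (\<Sum>i\<le>n. G i (Suc (n - i)))"
      using bdry(2)[of "Suc n"] that by (simp add: Suc_diff_le)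
    finally show ?thesis by (simp add: sum.distrib)
  qed
  have this_diag: "\<alpha> * S n = (\<Sum>i\<le>n. \<alpha> * (F i (n - i) + G i (n - i)))" for n
    by (simp add: S_def antidiagonal_sum sum_distrib_left)
  have le: "S (Suc n) \<le> \<alpha> * S n" if "z \<le> n" for n
    unfolding next_diag[OF that] this_diag by (intro sum_mono step)
  obtain i where i: "i \<le> z" "F i (z - i) + G i (z - i) \<noteq> 0"
    using \<open>S z \<noteq> 0\<close> unfolding S_def antidiagonal_sum by (meson atMost_iff sum.neutral)
  then have "S (Suc z) < \<alpha> * S z"
    unfolding next_diag[OF order_refl] this_diag
    by (intro sum_strict_mono_ex1) (auto intro: step strict)
  moreover have "S n \<le> \<alpha> ^ (n - Suc z) * S (Suc z)" if "Suc z \<le> n" for n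
    using that
  proof (induction rule: dec_induct)
    case (step n)
    have "S (Suc n) \<le> \<alpha> * S n" using step.hyps by (intro le) simp
    also have "\<dots> \<le> \<alpha> * (\<alpha> ^ (n - Suc z) * S (Suc z))"
      using step.IH \<open>0 < \<alpha>\<close> by simp
    also have "\<dots> = \<alpha> ^ (Suc n - Suc z) * S (Suc z)"
      by (simp add: power_Suc[symmetric] Suc_diff_le step.hyps mult.assoc[symmetric] del: power_Suc diff_Suc_Suc)
    finally show ?case .
  qed simp
  then have "S D \<le> \<alpha> ^ (D - Suc z) * S (Suc z)" using \<open>z < D\<close> by simp
  ultimately have "S D < \<alpha> ^ (D - Suc z) * (\<alpha> * S z)"
    using \<open>0 < \<alpha>\<close> by (smt (verit) mult_le_cancel_left_pos zero_less_power)
  also have "\<dots> = \<alpha> ^ (D - z) * S z"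
    using \<open>z < D\<close> by (simp add: Suc_diff_Suc[symmetric] mult_ac)
  finally show ?thesis .
qed

section \<open>The linear matrix inequalities\<close>

text \<open>
  The direction of the Schur complement criterion that yields a bound, obtained by evaluating
  the form of the large matrix at one vector. With \<open>f = F *v \<xi>\<close> and \<open>g = G *v \<xi>\<close>, the
  vector \<open>(\<xi>, T1 *v f, T2 *v f, g)\<close> maximises the form for given \<open>\<xi>\<close>: the mixed term \<open>2 * (f \<bullet> (T1 *v f))\<close> and the diagonal term
  \<open>- (f \<bullet> (T1 *v f))\<close> add up to \<open>f \<bullet> (T1 *v f)\<close>.
\<close>

lemma neg_def_schur:
  fixes \<Phi>1 :: "real^'m^'m" and F G :: "real^'m^'n" and P R1 R2 T1 T2 :: "real^'n^'n"
  assumes neg: "pos_def (- block_sym \<Phi>1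
        (block_row (transpose F) (block_row (transpose F) (transpose G ** P)))
        (block_sym (- R1) (block_row 0 0) (block_sym (- R2) 0 (- P))))"
    and inv: "\<And>u. R1 *v (T1 *v u) = u" "\<And>u. R2 *v (T2 *v u) = u"
    and "\<xi> \<noteq> 0"
  shows "\<xi> \<bullet> (\<Phi>1 *v \<xi>) + (F *v \<xi>) \<bullet> (T1 *v (F *v \<xi>)) + (F *v \<xi>) \<bullet> (T2 *v (F *v \<xi>))
    + (G *v \<xi>) \<bullet> (P *v (G *v \<xi>)) < 0"
proof -
  define f where "f = F *v \<xi>"
  define g where "g = G *v \<xi>"
  define v where "v = block_vec \<xi> (block_vec (T1 *v f) (block_vec (T2 *v f) g))"
  have "v \<noteq> 0" using \<open>\<xi> \<noteq> 0\<close> by (simp add: v_def block_vec_eq_0_iff)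
  then have "v \<bullet> (block_sym \<Phi>1
        (block_row (transpose F) (block_row (transpose F) (transpose G ** P)))
        (block_sym (- R1) (block_row 0 0) (block_sym (- R2) 0 (- P))) *v v) < 0"
    using neg by (simp add: pos_def_def uminus_mult_vec)
  moreover have "\<xi> \<bullet> (transpose F *v y) = f \<bullet> y" "\<xi> \<bullet> (transpose G *v y) = g \<bullet> y" for y
    by (simp_all add: f_def g_def inner_transpose_mult inner_commute del: transpose_matrix_vector)
  ultimately show ?thesis
    unfolding v_def quadform_block_sym f_def[symmetric] g_def[symmetric]
    by (simp add: block_row_mult uminus_mult_vec inner_add_right inv
        matrix_vector_mul_assoc[symmetric] inner_commute[of "T1 *v f"] inner_commute[of "T2 *v f"]
        del: transpose_matrix_vector)
qed

text \<open>
  All blocks of \<open>\<Phi>1\<close> are block diagonal with respect to the two directions, so the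
  quadratic form splits into a horizontal and a vertical share.
\<close>

lemma lmi_form_sum:
  fixes P Q1 Q2 X11 X12 X22 Y11 Y12 Y22 M1 M2 N1 N2 S1 S2 \<Lambda>1 \<Lambda>2 \<Lambda>3 \<Lambda>4
      :: "real^('h::finite + 'v::finite)^('h + 'v)"
  assumes "P = block_diag Ph Pv" "Q1 = block_diag Q1h Q1v" "Q2 = block_diag Q2h Q2v"
    and "Xh = block_sym X11h X12h X22h" "Xv = block_sym X11v X12v X22v"
      "Yh = block_sym Y11h Y12h Y22h" "Yv = block_sym Y11v Y12v Y22v"
    and "Mh = block_col M1h M2h" "Mv = block_col M1v M2v"
      "Nh = block_col N1h N2h" "Nv = block_col N1v N2v"
      "Sh = block_col S1h S2h" "Sv = block_col S1v S2v"
    and "\<Lambda>1 = block_diag (mat (real dhL)) (mat (real dvL))"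
      "\<Lambda>2 = block_diag (mat (real dhH - real dhL)) (mat (real dvH - real dvL))"
      "\<Lambda>3 = block_diag (mat (\<alpha> ^ dhL)) (mat (\<alpha> ^ dvL))"
      "\<Lambda>4 = block_diag (mat (\<alpha> ^ dhH)) (mat (\<alpha> ^ dvH))"
    and "X11 = block_diag X11h X11v" "X12 = block_diag X12h X12v" "X22 = block_diag X22h X22v"
      "Y11 = block_diag Y11h Y11v" "Y12 = block_diag Y12h Y12v" "Y22 = block_diag Y22h Y22v"
    and "M1 = block_diag M1h M1v" "M2 = block_diag M2h M2v"
      "N1 = block_diag N1h N1v" "N2 = block_diag N2h N2v"
      "S1 = block_diag S1h S1v" "S2 = block_diag S2h S2v"
    and "\<Phi>11 = Q1 + Q2 + \<Lambda>3 ** (M1 + transpose M1 + \<Lambda>1 ** X11) + \<Lambda>2 ** \<Lambda>4 ** Y11 - \<alpha> *\<^sub>R P"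
      "\<Phi>12 = \<Lambda>3 ** (\<Lambda>1 ** X12 + transpose M2) + \<Lambda>4 ** (N1 - S1 + \<Lambda>2 ** Y12)"
      "\<Phi>13 = - (\<Lambda>3 ** M1) + \<Lambda>4 ** S1"
      "\<Phi>14 = - (\<Lambda>4 ** N1)"
      "\<Phi>22 = \<Lambda>1 ** \<Lambda>3 ** X22 + \<Lambda>4 ** (N2 + transpose N2 - S2 - transpose S2 + \<Lambda>2 ** Y22)"
      "\<Phi>23 = - (\<Lambda>3 ** M2) + \<Lambda>4 ** S2"
      "\<Phi>24 = - (\<Lambda>4 ** N2)"
      "\<Phi>33 = - (\<Lambda>3 ** Q1)"
      "\<Phi>44 = - (\<Lambda>4 ** Q2)"
    and "\<Phi>1 = block_sym \<Phi>11 (block_row \<Phi>12 (block_row \<Phi>13 \<Phi>14))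
               (block_sym \<Phi>22 (block_row \<Phi>23 \<Phi>24)
                 (block_sym \<Phi>33 0 \<Phi>44))"
    and "\<xi> = block_vec (block_vec xh xv) (block_vec (block_vec yh yv)
               (block_vec (block_vec uh uv) (block_vec wh wv)))"
  shows "\<xi> \<bullet> (\<Phi>1 *v \<xi>) = lmi_form \<alpha> dhL dhH Ph Q1h Q2h Xh Yh Mh Nh Sh xh yh uh wh
      + lmi_form \<alpha> dvL dvH Pv Q1v Q2v Xv Yv Mv Nv Sv xv yv uv wv"
proof -
  note mult = matrix_vector_mul_assoc[symmetric] matrix_vector_mult_add_rdistrib
    matrix_vector_mult_diff_rdistrib scaleR_matrix_vector_assoc[symmetric] uminus_mult_vec
    transpose_block_diag block_diag_mult block_row_mult mat_mult_vec
  note inner = inner_block_vec inner_add_right inner_diff_right inner_transpose_mult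
  show ?thesis
    unfolding assms lmi_form_def Let_def quadform_block_sym block_col_mult
    by (simp add: mult inner matrix_vector_right_distrib matrix_vector_mult_diff_distrib
        matrix_vector_mult_scaleR algebra_simps del: transpose_matrix_vector)
qed

section \<open>Decay of the functional along trajectories\<close>

lemma block_diag_mat_ker:
  fixes x :: "real^('a::finite + 'b::finite)"
  assumes "block_diag (mat a) (mat b) *v x = 0" "a \<noteq> 0" "b \<noteq> 0"
  shows "x = 0"
proof -
  have "x = block_vec (\<chi> i. x $ Inl i) (\<chi> i. x $ Inr i)"
    by (simp add: vec_eq_iff_blocks)
  with assms show ?thesis
    by (metis block_diag_mult block_vec_eq_0_iff mat_mult_vec scaleR_eq_0_iff)
qed

text \<open>
  The strict inequality at \<open>(i, j)\<close> comes from the matrix inequality if the vector \<open>\<xi>\<close> of current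
  and delayed states is nonzero. If \<open>\<xi> = 0\<close>, the system equation makes the next state zero as well,
  and \<open>lk_part_at_rest\<close> applies.
\<close>

theorem lemma4:
  fixes A Ad :: "real^('h::finite + 'v::finite)^('h + 'v)"
    and dh dv :: "nat \<Rightarrow> nat"
    and dhL dhH dvL dvH z1 z2 D z :: nat
    and hb xh :: "int \<Rightarrow> nat \<Rightarrow> real^'h"
    and vb xv :: "nat \<Rightarrow> int \<Rightarrow> real^'v"
    and V :: "nat \<Rightarrow> nat \<Rightarrow> real"
    and \<alpha> :: real
    and Ph Q1h Q2h W1h W2h X11h X12h X22h Y11h Y12h Y22h :: "real^'h^'h"
    and M1h M2h N1h N2h S1h S2h :: "real^'h^'h"
    and Pv Q1v Q2v W1v W2v X11v X12v X22v Y11v Y12v Y22v :: "real^'v^'v"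
    and M1v M2v N1v N2v S1v S2v :: "real^'v^'v"
    and Xh Yh :: "real^('h + 'h)^('h + 'h)" and Mh Nh Sh :: "real^'h^('h + 'h)"
    and Xv Yv :: "real^('v + 'v)^('v + 'v)" and Mv Nv Sv :: "real^'v^('v + 'v)"
    and \<Psi>1h \<Psi>2h \<Psi>3h :: "real^(('h + 'h) + 'h)^(('h + 'h) + 'h)"
    and \<Psi>1v \<Psi>2v \<Psi>3v :: "real^(('v + 'v) + 'v)^(('v + 'v) + 'v)"
    and P Q1 Q2 W1 W2 X11 X12 X22 Y11 Y12 Y22 M1 M2 N1 N2 S1 S2 \<Lambda>1 \<Lambda>2 \<Lambda>3 \<Lambda>4
      \<Phi>11 \<Phi>12 \<Phi>13 \<Phi>14 \<Phi>22 \<Phi>23 \<Phi>24 \<Phi>33 \<Phi>44 :: "real^('h + 'v)^('h + 'v)"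
  assumes "0 < dhL" "dhL < dhH" "0 < dvL" "dvL < dvH"
    and "\<And>i. dhL \<le> dh i \<and> dh i \<le> dhH" "\<And>j. dvL \<le> dv j \<and> dv j \<le> dvH"
    and "0 < z1" "0 < z2"
    and "delay_system A Ad dh dv xh xv"
    and "boundary_conditions dhH dvH z1 z2 hb vb xh xv"
    and "0 < \<alpha>" "\<alpha> \<le> 1"
    and "P = block_diag Ph Pv" "Q1 = block_diag Q1h Q1v" "Q2 = block_diag Q2h Q2v"
      "W1 = block_diag W1h W1v" "W2 = block_diag W2h W2v"
    and "pos_def P" "pos_def Q1" "pos_def Q2" "pos_def W1" "pos_def W2"
    and "Xh = block_sym X11h X12h X22h" "Xv = block_sym X11v X12v X22v"
      "Yh = block_sym Y11h Y12h Y22h" "Yv = block_sym Y11v Y12v Y22v"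
    and "pos_def Xh" "pos_def Xv" "pos_def Yh" "pos_def Yv"
    and "Mh = block_col M1h M2h" "Mv = block_col M1v M2v"
      "Nh = block_col N1h N2h" "Nv = block_col N1v N2v"
      "Sh = block_col S1h S2h" "Sv = block_col S1v S2v"
    and "\<Lambda>1 = block_diag (mat (real dhL)) (mat (real dvL))"
      "\<Lambda>2 = block_diag (mat (real dhH - real dhL)) (mat (real dvH - real dvL))"
      "\<Lambda>3 = block_diag (mat (\<alpha> ^ dhL)) (mat (\<alpha> ^ dvL))"
      "\<Lambda>4 = block_diag (mat (\<alpha> ^ dhH)) (mat (\<alpha> ^ dvH))"
    and "X11 = block_diag X11h X11v" "X12 = block_diag X12h X12v" "X22 = block_diag X22h X22v"
      "Y11 = block_diag Y11h Y11v" "Y12 = block_diag Y12h Y12v" "Y22 = block_diag Y22h Y22v"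
    and "M1 = block_diag M1h M1v" "M2 = block_diag M2h M2v"
      "N1 = block_diag N1h N1v" "N2 = block_diag N2h N2v"
      "S1 = block_diag S1h S1v" "S2 = block_diag S2h S2v"
    and "\<Phi>11 = Q1 + Q2 + \<Lambda>3 ** (M1 + transpose M1 + \<Lambda>1 ** X11) + \<Lambda>2 ** \<Lambda>4 ** Y11 - \<alpha> *\<^sub>R P"
      "\<Phi>12 = \<Lambda>3 ** (\<Lambda>1 ** X12 + transpose M2) + \<Lambda>4 ** (N1 - S1 + \<Lambda>2 ** Y12)"
      "\<Phi>13 = - (\<Lambda>3 ** M1) + \<Lambda>4 ** S1"
      "\<Phi>14 = - (\<Lambda>4 ** N1)"
      "\<Phi>22 = \<Lambda>1 ** \<Lambda>3 ** X22 + \<Lambda>4 ** (N2 + transpose N2 - S2 - transpose S2 + \<Lambda>2 ** Y22)"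
      "\<Phi>23 = - (\<Lambda>3 ** M2) + \<Lambda>4 ** S2"
      "\<Phi>24 = - (\<Lambda>4 ** N2)"
      "\<Phi>33 = - (\<Lambda>3 ** Q1)"
      "\<Phi>44 = - (\<Lambda>4 ** Q2)"
    and "\<Phi>1 = block_sym \<Phi>11 (block_row \<Phi>12 (block_row \<Phi>13 \<Phi>14))
               (block_sym \<Phi>22 (block_row \<Phi>23 \<Phi>24)
                 (block_sym \<Phi>33 0 \<Phi>44))"
      "\<Phi>2 = block_row (A - mat 1) (block_row Ad (block_row 0 0))"
      "\<Phi>3 = block_row A (block_row Ad (block_row 0 0))"
    and "\<Phi> = block_sym \<Phi>1
               (block_row (transpose \<Phi>2) (block_row (transpose \<Phi>2) (transpose \<Phi>3 ** P)))
               (block_sym (- (matrix_inv \<Lambda>1 ** matrix_inv W1)) (block_row 0 0)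
                 (block_sym (- (matrix_inv \<Lambda>2 ** matrix_inv W2)) 0 (- P)))"
    and "pos_def (- \<Phi>)"
    and "\<Psi>1h = block_sym Xh Mh W1h" "\<Psi>2h = block_sym Yh Nh W2h" "\<Psi>3h = block_sym Yh Sh W2h"
      "\<Psi>1v = block_sym Xv Mv W1v" "\<Psi>2v = block_sym Yv Nv W2v" "\<Psi>3v = block_sym Yv Sv W2v"
    and "pos_semidef (block_diag \<Psi>1h (block_diag \<Psi>2h (block_diag \<Psi>3h
           (block_diag \<Psi>1v (block_diag \<Psi>2v \<Psi>3v)))))"
    and "\<And>i j. V i j =
           lk_part \<alpha> dhL dhH Ph Q1h Q2h W1h W2h (\<lambda>r. xh r j) (int i) +
           lk_part \<alpha> dvL dvH Pv Q1v Q2v W1v W2v (\<lambda>t. xv i t) (int j)"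
    and "max z1 z2 \<le> z" "z < D"
    and "(\<Sum>(i, j)\<in>{(i, j). i + j = z}. V i j) \<noteq> 0"
  shows "(\<Sum>(i, j)\<in>{(i, j). i + j = D}. V i j) <
           \<alpha> ^ (D - z) * (\<Sum>(i, j)\<in>{(i, j). i + j = z}. V i j)"
proof -
  note delays = assms(1-4) assms(5,6)[THEN conjunct1] assms(5,6)[THEN conjunct2]
  note sys = assms(9) and bc = assms(10) and \<alpha> = assms(11,12)
  note lambda_def = assms(37,38) and W_def = assms(16,17)
  have W: "pos_def W1h" "pos_def W1v" "pos_def W2h" "pos_def W2v"
    using assms(21,22) unfolding W_def by (auto dest: pos_def_block_diagD)
  have \<Psi>: "pos_semidef (block_sym Xh Mh W1h)" "pos_semidef (block_sym Yh Nh W2h)"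
    "pos_semidef (block_sym Yh Sh W2h)" "pos_semidef (block_sym Xv Mv W1v)"
    "pos_semidef (block_sym Yv Nv W2v)" "pos_semidef (block_sym Yv Sv W2v)"
    using assms(73) unfolding assms(67-72) by (blast dest: pos_semidef_block_diagD)+
  define F where "F i j = lk_part \<alpha> dhL dhH Ph Q1h Q2h W1h W2h (\<lambda>r. xh r j) (int i)" for i j
  define G where "G i j = lk_part \<alpha> dvL dvH Pv Q1v Q2v W1v W2v (\<lambda>t. xv i t) (int j)" for i j
  have V: "V = (\<lambda>i j. F i j + G i j)"
    using assms(74) by (simp add: F_def G_def fun_eq_iff)
  have local: "F (Suc i) j + G i (Suc j) \<le> \<alpha> * (F i j + G i j) \<and>
      (F i j + G i j \<noteq> 0 \<longrightarrow> F (Suc i) j + G i (Suc j) < \<alpha> * (F i j + G i j))" for i j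
  proof -
    define nx where "nx = block_vec (xh (int i + 1) j) (xv i (int j + 1))"
    define x where "x = block_vec (xh (int i) j) (xv i (int j))"
    define y where "y = block_vec (xh (int i - int (dh i)) j) (xv i (int j - int (dv j)))"
    define u where "u = block_vec (xh (int i - int dhL) j) (xv i (int j - int dvL))"
    define w where "w = block_vec (xh (int i - int dhH) j) (xv i (int j - int dvH))"
    define \<xi> where "\<xi> = block_vec x (block_vec y (block_vec u w))"
    have nx: "nx = A *v x + Ad *v y"
      using sys by (simp add: delay_system_def nx_def x_def y_def)
    show ?thesis
    proof (cases "\<xi> = 0")
      case True
      then have "x = 0" "y = 0" "u = 0" "w = 0"
        by (simp_all add: \<xi>_def block_vec_eq_0_iff)
      moreover from this have "nx = 0" by (simp add: nx)
      ultimately have rest: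
        "xh (int i) j = 0" "xh (int i + 1) j = 0" "xh (int i - int dhL) j = 0" "xh (int i - int dhH) j = 0"
        "xv i (int j) = 0" "xv i (int j + 1) = 0" "xv i (int j - int dvL) = 0" "xv i (int j - int dvH) = 0"
        by (simp_all add: nx_def x_def u_def w_def block_vec_eq_0_iff)
      have h: "F (Suc i) j \<le> \<alpha> * F i j" "F i j \<noteq> 0 \<Longrightarrow> F (Suc i) j < \<alpha> * F i j"
        using lk_part_at_rest[where x = "\<lambda>r. xh r j" and k = "int i", OF \<alpha>(1) _ W(1,3) rest(1-4)] delays
        by (auto simp: F_def add.commute)
      have v: "G i (Suc j) \<le> \<alpha> * G i j" "G i j \<noteq> 0 \<Longrightarrow> G i (Suc j) < \<alpha> * G i j"
        using lk_part_at_rest[where x = "xv i" and k = "int j", OF \<alpha>(1) _ W(2,4) rest(5-8)] delays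
        by (auto simp: G_def add.commute)
      from h v show ?thesis
        by (cases "F i j = 0"; cases "G i j = 0") (fastforce simp: distrib_left)+
    next
      case False
      have form: "\<xi> \<bullet> (\<Phi>1 *v \<xi>) =
          lmi_form \<alpha> dhL dhH Ph Q1h Q2h Xh Yh Mh Nh Sh (xh (int i) j) (xh (int i - int (dh i)) j)
            (xh (int i - int dhL) j) (xh (int i - int dhH) j)
        + lmi_form \<alpha> dvL dvH Pv Q1v Q2v Xv Yv Mv Nv Sv (xv i (int j)) (xv i (int j - int (dv j)))
            (xv i (int j - int dvL)) (xv i (int j - int dvH))"
        unfolding \<xi>_def x_def y_def u_def w_def
        by (rule lmi_form_sum[OF assms(13-15,23-26,31-62) refl])
      have \<Phi>3: "\<Phi>3 *v \<xi> = nx"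
        by (simp add: assms(64) \<xi>_def block_row_mult nx)
      have \<Phi>2: "\<Phi>2 *v \<xi> = nx - x"
        by (simp add: assms(63) \<xi>_def block_row_mult nx matrix_vector_mult_diff_rdistrib)
      (* The second diagonal block of \<Phi> is minus the inverse of W1 ** \<Lambda>1,
         the third minus that of W2 ** \<Lambda>2. *)
      have inv: "(matrix_inv L ** matrix_inv U) *v ((U ** L) *v q) = q"
        if "\<And>q. L *v q = 0 \<Longrightarrow> q = 0" "pos_def U" for L U :: "real^('h + 'v)^('h + 'v)" and q
        using matrix_inv_mult_vec[where A = U and x = "L *v q", OF pos_def_ker[OF that(2)]]
          matrix_inv_mult_vec[where A = L and x = q, OF that(1)]
        by (simp add: matrix_vector_mul_assoc[symmetric])
      have ker: "\<Lambda>1 *v q = 0 \<Longrightarrow> q = 0" "\<Lambda>2 *v q = 0 \<Longrightarrow> q = 0" for q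
        using delays unfolding lambda_def by (auto dest!: block_diag_mat_ker)
      have "\<xi> \<bullet> (\<Phi>1 *v \<xi>) + (nx - x) \<bullet> ((W1 ** \<Lambda>1) *v (nx - x))
          + (nx - x) \<bullet> ((W2 ** \<Lambda>2) *v (nx - x)) + nx \<bullet> (P *v nx) < 0"
        using neg_def_schur[OF assms(66)[unfolded assms(65)] inv[OF ker(1) assms(21)] inv[OF ker(2) assms(22)] False]
        unfolding \<Phi>2 \<Phi>3 .
      then have "\<alpha> * F i j + \<alpha> * G i j > F (Suc i) j + G i (Suc j)"
        using lk_part_step_le[where x = "\<lambda>r. xh r j" and k = "int i" and d = "dh i"
              and P = Ph and ?Q1.0 = Q1h and ?Q2.0 = Q2h,
            OF \<alpha> delays(5,7) W(1,3) \<Psi>(1-3)]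
          lk_part_step_le[where x = "xv i" and k = "int j" and d = "dv j"
              and P = Pv and ?Q1.0 = Q1v and ?Q2.0 = Q2v,
            OF \<alpha> delays(6,8) W(2,4) \<Psi>(4-6)]
        unfolding form
        by (simp add: F_def G_def nx_def x_def block_vec_diff assms(13) W_def lambda_def
            matrix_vector_mul_assoc[symmetric] block_diag_mult mat_mult_vec inner_block_vec
            matrix_vector_mult_scaleR add.commute[of 1])
      then show ?thesis by (simp add: distrib_left)
    qed
  qed
  (* F 0 n depends on xh r n only for - dhH \<le> r \<le> 0, where it is zero as n > z1; likewise G n 0. *)
  have F0: "F 0 n = 0" if "z < n" for n
    unfolding F_def using bc assms(75) that delays
    by (intro lk_part_eq_0) (auto simp: boundary_conditions_def)
  have G0: "G n 0 = 0" if "z < n" for n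
    unfolding G_def using bc assms(75) that delays
    by (intro lk_part_eq_0) (auto simp: boundary_conditions_def)
  show ?thesis
    using assms(77) antidiagonal_decay[of \<alpha> F G z D, OF \<alpha>(1) _ _ F0 G0 assms(76)] local
    unfolding V by blast
qed

end
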